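(* Let $r\ge1$, let $p_1,\dots,p_r\ge5$ be distinct primes, $P=p_1\cdots p_r$ and $M=6P$. Let $n$ be a positive integer. If $$\frac nM\kappa_P(n)\ge 3^r-1,$$ then $g_P(2n)>0$.
   Context: $g_P(2n)$ is the number of pairs $(h,k)\in\mathbb Z_{>0}^2$ with $h+k=2n$, $h\le k$, $\gcd(h,M)=\gcd(k,M)=1$. For $q\in\mathbb Z_{>0}$, $x\in\mathbb Z$, $\delta_q(x)=x-q\lfloor x/q\rfloor$. $\mathbf 1_{\{\cdot\}}$ denotes an indicator, $\varepsilon_i(n)=\mathbf 1_{\{\delta_{p_i}(n)=0\}}$, and $$\kappa_P(n)=\bigl(1+\mathbf 1_{\{\delta_3(n)=0\}}\bigr)\prod_{i=1}^r\bigl(p_i-2+\varepsilon_i(n)\bigr).$$ *)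

theory Defs
  imports Complex_Main "HOL-Computational_Algebra.Primes"
begin

definition delta :: "nat \<Rightarrow> int \<Rightarrow> int" where
  "delta q x = x - int q * \<lfloor>real_of_int x / real q\<rfloor>"

(* The modulus M = 6 * P is written out. The positivity of h and k is explicit
   since they range over nat. *)
definition gP :: "nat \<Rightarrow> nat \<Rightarrow> nat" where
  "gP P N = card {(h, k). 0 < h \<and> 0 < k \<and> h + k = N \<and> h \<le> k \<and>
                          gcd h (6 * P) = 1 \<and> gcd k (6 * P) = 1}"

definition eps :: "(nat \<Rightarrow> nat) \<Rightarrow> nat \<Rightarrow> nat \<Rightarrow> int" where
  "eps p i n = of_bool (delta (p i) (int n) = 0)"

(* The primes p 1, ..., p r are passed instead of their product P;
   int is used so that p i - 2 is not truncated. *)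
definition kappa :: "nat \<Rightarrow> (nat \<Rightarrow> nat) \<Rightarrow> nat \<Rightarrow> int" where
  "kappa r p n = (1 + of_bool (delta 3 (int n) = 0)) *
                 (\<Prod>i = 1..r. int (p i) - 2 + eps p i n)"

end

(* By the symmetry h <-> 2n - h it suffices to find h < 2n with h and 2n - h prime to 6P.
   Fix one residue class mod 6 that takes care of the primes 2 and 3, and sieve out the classes
   0 and 2n modulo every p_i by inclusion-exclusion. This leaves at most 3^r arithmetic
   progressions, each counted with an error below 1, so the total error is below 3^r. If 3 does
   not divide n, the main term is twice the left-hand side of the hypothesis, which is enough.
   If 3 divides n, the main term is only equal to it, but then 6 divides 2n, so the progression
   mod 6 is counted exactly and the total error is below 3^r - 1. *)
theory Submission
  imports Defs "HOL-Number_Theory.Cong"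
begin

section \<open>Counting in arithmetic progressions\<close>

lemma card_cong_block:
  fixes m :: nat
  assumes "m > 0"
  shows "card {h \<in> {x..<x + m}. [h = a] (mod m)} = 1"
proof -
  \<comment> \<open>The summand \<open>m * x\<close> vanishes mod \<open>m\<close> and keeps the
    subtraction of naturals from truncating.\<close>
  define y where "y = x + (a + m * x - x) mod m"
  have le: "x \<le> a + m * x" using assms by (cases m) auto
  have "[y = x + (a + m * x - x)] (mod m)" unfolding y_def by (simp add: cong_def mod_simps)
  also have "x + (a + m * x - x) = a + m * x" using le by simp
  finally have y: "[y = a] (mod m)" by (simp add: cong_def)
  have yin: "y \<in> {x..<x + m}" using assms by (simp add: y_def)
  have "h = y" if h: "h \<in> {x..<x + m}" "[h = a] (mod m)" for h
  proof -
    have "[h = y] (mod m)" using h(2) y cong_sym cong_trans by blast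
    moreover obtain i j where ij: "h = i + x" "i < m" "y = j + x" "j < m"
      using h(1) yin by (metis add.commute atLeastLessThan_iff le_Suc_ex nat_add_left_cancel_less)
    ultimately have "[i = j] (mod m)" by (simp add: cong_add_rcancel_nat)
    with ij show ?thesis by (simp add: cong_less_modulus_unique_nat)
  qed
  with y yin have "{h \<in> {x..<x + m}. [h = a] (mod m)} = {y}" by blast
  then show ?thesis by simp
qed

lemma card_cong_less_add:
  fixes m :: nat
  assumes "m > 0"
  shows "card {h. h < N + m \<and> [h = a] (mod m)} = card {h. h < N \<and> [h = a] (mod m)} + 1"
proof -
  let ?A = "{h. h < N \<and> [h = a] (mod m)}" and ?B = "{h \<in> {N..<N + m}. [h = a] (mod m)}"
  have "{h. h < N + m \<and> [h = a] (mod m)} = ?A \<union> ?B" by auto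
  moreover have "card (?A \<union> ?B) = card ?A + card ?B" by (rule card_Un_disjoint) auto
  ultimately show ?thesis by (simp only: card_cong_block[OF assms])
qed

lemma card_cong_less_multiple:
  fixes m :: nat
  assumes "m > 0"
  shows "card {h. h < m * k \<and> [h = a] (mod m)} = k"
proof (induction k)
  case (Suc k)
  have "m * Suc k = m * k + m" by simp
  then show ?case using card_cong_less_add[OF assms, of "m * k" a] Suc by (simp only: Suc_eq_plus1)
qed simp

text \<open>Dropping a block of length \<open>m\<close> lowers both the count and the quotient by 1,
  so everything reduces to \<open>N < m\<close>, where the count is at most 1.\<close>

lemma card_cong_less_error:
  fixes m :: nat
  assumes "m > 0"
  shows "\<bar>real (card {h. h < N \<and> [h = a] (mod m)}) - real N / real m\<bar> < 1"
proof (induction N rule: less_induct)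
  case (less N)
  show ?case
  proof (cases "N < m")
    case True
    have "{h. h < N \<and> [h = a] (mod m)} \<subseteq> {a mod m}"
    proof
      fix h assume "h \<in> {h. h < N \<and> [h = a] (mod m)}"
      then have "h < m" "h mod m = a mod m" using True by (simp_all add: cong_def)
      then show "h \<in> {a mod m}" by (metis mod_less singletonI)
    qed
    then have le: "card {h. h < N \<and> [h = a] (mod m)} \<le> 1"
      using card_mono[of "{a mod m}"] by simp
    \<comment> \<open>At \<open>N = 0\<close> the estimate \<open>le\<close> alone would allow an
      error of exactly 1, but the count is 0 there.\<close>
    show ?thesis
    proof (cases "N = 0")
      case False
      then have "0 < real N / real m" "real N / real m < 1" using True by auto
      with le show ?thesis by linarith
    qed simp
  next
    case False
    have "(N - m) + m = N" using False by simp
    then have "real (card {h. h < N \<and> [h = a] (mod m)}) =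
          real (card {h. h < N - m \<and> [h = a] (mod m)}) + 1"
      using card_cong_less_add[OF assms, of "N - m" a] by simp
    moreover have "real N / real m = real (N - m) / real m + 1"
      using False assms by (simp add: of_nat_diff field_simps)
    moreover have "N - m < N" using False assms by simp
    ultimately show ?thesis using less.IH[of "N - m"] by simp
  qed
qed

section \<open>Sieving two residue classes for each modulus\<close>

text \<open>The progression \<open>a\<close> mod \<open>m\<close> is kept as a parameter because
  removing a class mod \<open>q\<close> leads to sets of the same kind with modulus
  \<open>m * q\<close>.\<close>

definition sieve_set ::
    "(nat \<Rightarrow> nat) \<Rightarrow> (nat \<Rightarrow> nat) \<Rightarrow> nat \<Rightarrow> nat \<Rightarrow> nat \<Rightarrow> nat set \<Rightarrow> nat set" where
  "sieve_set u v N m a S =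
     {h. h < N \<and> [h = a] (mod m) \<and> (\<forall>q\<in>S. \<not> [h = u q] (mod q) \<and> \<not> [h = v q] (mod q))}"

text \<open>Each factor is the proportion of residue classes mod \<open>q\<close> that survive; the
  two forbidden classes may coincide.\<close>

definition sieve_density :: "(nat \<Rightarrow> nat) \<Rightarrow> (nat \<Rightarrow> nat) \<Rightarrow> nat set \<Rightarrow> real" where
  "sieve_density u v S = (\<Prod>q\<in>S. 1 - (if [u q = v q] (mod q) then 1 else 2) / real q)"

lemma finite_sieve_set [simp]: "finite (sieve_set u v N m a S)"
  by (rule finite_subset[of _ "{..<N}"]) (auto simp: sieve_set_def)

lemma cong_pair_iff_cong_mult:
  fixes m q :: nat
  assumes "coprime m q"
  obtains x where "\<And>h. [h = a] (mod m) \<and> [h = b] (mod q) \<longleftrightarrow> [h = x] (mod (m * q))"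
proof -
  obtain x where x: "[x = a] (mod m)" "[x = b] (mod q)"
    using binary_chinese_remainder_nat[OF assms] by blast
  have "[h = a] (mod m) \<and> [h = b] (mod q) \<longleftrightarrow> [h = x] (mod (m * q))" for h
  proof -
    have "[h = a] (mod m) \<and> [h = b] (mod q) \<longleftrightarrow> [h = x] (mod m) \<and> [h = x] (mod q)"
      using x by (simp add: cong_def)
    also have "\<dots> \<longleftrightarrow> [h = x] (mod (m * q))"
      using coprime_cong_mult_nat[OF _ _ assms] cong_modulus_mult_nat
      by (metis mult.commute)
    finally show ?thesis .
  qed
  then show thesis by (rule that)
qed

text \<open>By the Chinese remainder theorem, the elements lost to each forbidden class mod
  \<open>q\<close> form a sieve set of modulus \<open>m * q\<close>. The two lost sets are equal or
  disjoint.\<close>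

lemma card_sieve_set_insert:
  assumes "coprime m q"
  obtains b c where
    "real (card (sieve_set u v N m a (insert q S))) =
       real (card (sieve_set u v N m a S)) - real (card (sieve_set u v N (m * q) b S))
       - (if [u q = v q] (mod q) then 0 else real (card (sieve_set u v N (m * q) c S)))"
proof -
  obtain b where b: "\<And>h. [h = a] (mod m) \<and> [h = u q] (mod q) \<longleftrightarrow> [h = b] (mod (m * q))"
    using cong_pair_iff_cong_mult[OF assms] by blast
  obtain c where c: "\<And>h. [h = a] (mod m) \<and> [h = v q] (mod q) \<longleftrightarrow> [h = c] (mod (m * q))"
    using cong_pair_iff_cong_mult[OF assms] by blast
  let ?A = "sieve_set u v N m a S" and ?A' = "sieve_set u v N m a (insert q S)"
  let ?B = "sieve_set u v N (m * q) b S" and ?C = "sieve_set u v N (m * q) c S"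
  have B: "?B = {h \<in> ?A. [h = u q] (mod q)}" and C: "?C = {h \<in> ?A. [h = v q] (mod q)}"
    using b c unfolding sieve_set_def by blast+
  have A: "?A = ?A' \<union> (?B \<union> ?C)" "?A' \<inter> (?B \<union> ?C) = {}"
    unfolding B C by (auto simp: sieve_set_def)
  then have card_A: "card ?A = card ?A' + card (?B \<union> ?C)"
    by (metis card_Un_disjoint finite_sieve_set finite_Un)
  show thesis
  proof (cases "[u q = v q] (mod q)")
    case True
    then have "?B = ?C" unfolding B C by (auto simp: cong_def)
    with True card_A show thesis by (intro that[of b c]) simp
  next
    case False
    then have "?B \<inter> ?C = {}" unfolding B C by (auto simp: cong_def)
    then have "card (?B \<union> ?C) = card ?B + card ?C" by (simp add: card_Un_disjoint)
    with False card_A show thesis by (intro that[of b c]) simp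
  qed
qed

text \<open>The main terms obey the recursion of the cardinalities. They do not depend on the
  residue, so both removed sets have the same one.\<close>

lemma sieve_density_insert:
  assumes "finite S" "q \<notin> S"
  shows "real N / real m * sieve_density u v (insert q S) =
           real N / real m * sieve_density u v S
           - (if [u q = v q] (mod q) then 1 else 2) * (real N / real (m * q) * sieve_density u v S)"
proof -
  have "real N / real m * ((1 - c / real q) * D) =
          real N / real m * D - c * (real N / real (m * q) * D)" for c D
    by (simp add: algebra_simps)
  then show ?thesis using assms by (simp add: sieve_density_def)
qed

text \<open>The bound by \<open>D\<close> is weak and the result strict, so that with
  \<open>E = 3 ^ k\<close> both \<open>D = 3 ^ k\<close> and \<open>D = 3 ^ k - 1\<close> fit. If
  the classes coincide, only one \<open>E\<close> is spent, and \<open>E > 0\<close>.\<close>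

lemma sieve_step_error:
  fixes A B C X Y D E :: real
  assumes "\<bar>A - X\<bar> \<le> D" "\<bar>B - Y\<bar> < E" "\<bar>C - Y\<bar> < E"
  shows "\<bar>A - B - (if Q then 0 else C) - (X - (if Q then 1 else 2) * Y)\<bar> < D + 2 * E"
  using assms by (cases Q; simp; linarith)

text \<open>A new modulus replaces one sieve set by at most three, so the bound triples, starting
  from 1 for a bare progression. The induction must let \<open>m\<close> and \<open>a\<close>
  vary.\<close>

lemma card_sieve_set_error:
  assumes "finite S" "m > 0" "\<And>q. q \<in> S \<Longrightarrow> q > 0" "\<And>q. q \<in> S \<Longrightarrow> coprime m q"
    and "pairwise coprime S"
  shows "\<bar>real (card (sieve_set u v N m a S)) - real N / real m * sieve_density u v S\<bar> < 3 ^ card S"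
  using assms
proof (induction S arbitrary: m a rule: finite_induct)
  case empty
  then show ?case
    using card_cong_less_error[of m N a] by (simp add: sieve_set_def sieve_density_def)
next
  case (insert q S)
  obtain b c where rec: "real (card (sieve_set u v N m a (insert q S))) =
       real (card (sieve_set u v N m a S)) - real (card (sieve_set u v N (m * q) b S))
       - (if [u q = v q] (mod q) then 0 else real (card (sieve_set u v N (m * q) c S)))"
    using card_sieve_set_insert[of m q u v N a S] insert.prems by auto
  have q: "q > 0" and S: "pairwise coprime S"
    using insert.prems by (auto simp: pairwise_insert)
  have "coprime (m * q) q'" if "q' \<in> S" for q'
    using that insert.hyps insert.prems by (auto simp: pairwise_insert)
  then have mq: "\<bar>real (card (sieve_set u v N (m * q) x S))
      - real N / real (m * q) * sieve_density u v S\<bar> < 3 ^ card S" for x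
    using insert.IH[of "m * q" x] insert.prems q S by simp
  have "\<bar>real (card (sieve_set u v N m a S)) - real N / real m * sieve_density u v S\<bar> < 3 ^ card S"
    using insert.IH[of m a] insert.prems S by simp
  from sieve_step_error[OF less_imp_le[OF this] mq[of b] mq[of c], of "[u q = v q] (mod q)"]
  show ?case
    unfolding rec sieve_density_insert[OF insert.hyps] card_insert_disjoint[OF insert.hyps]
    by simp
qed

text \<open>A bare progression now has error 0, which saves 1. The saving is inherited through the
  term that keeps the modulus \<open>m\<close>; the terms of modulus \<open>m * q\<close> get the
  general bound, whose strictness carries over.\<close>

lemma card_sieve_set_error_dvd:
  assumes "finite S" "m > 0" "\<And>q. q \<in> S \<Longrightarrow> q > 0" "\<And>q. q \<in> S \<Longrightarrow> coprime m q"
    and "pairwise coprime S" "m dvd N"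
  shows "\<bar>real (card (sieve_set u v N m a S)) - real N / real m * sieve_density u v S\<bar> \<le> 3 ^ card S - 1
    \<and> (S \<noteq> {} \<longrightarrow>
       \<bar>real (card (sieve_set u v N m a S)) - real N / real m * sieve_density u v S\<bar> < 3 ^ card S - 1)"
  using assms
proof (induction S rule: finite_induct)
  case empty
  then obtain k where "N = m * k" by blast
  with empty show ?case
    using card_cong_less_multiple[of m k a] by (simp add: sieve_set_def sieve_density_def)
next
  case (insert q S)
  obtain b c where rec: "real (card (sieve_set u v N m a (insert q S))) =
       real (card (sieve_set u v N m a S)) - real (card (sieve_set u v N (m * q) b S))
       - (if [u q = v q] (mod q) then 0 else real (card (sieve_set u v N (m * q) c S)))"
    using card_sieve_set_insert[of m q u v N a S] insert.prems by auto
  have q: "q > 0" and S: "pairwise coprime S"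
    using insert.prems by (auto simp: pairwise_insert)
  have "coprime (m * q) q'" if "q' \<in> S" for q'
    using that insert.hyps insert.prems by (auto simp: pairwise_insert)
  then have mq: "\<bar>real (card (sieve_set u v N (m * q) x S))
      - real N / real (m * q) * sieve_density u v S\<bar> < 3 ^ card S" for x
    using card_sieve_set_error[of S "m * q"] insert.hyps insert.prems q S by simp
  have "\<bar>real (card (sieve_set u v N m a S)) - real N / real m * sieve_density u v S\<bar> \<le> 3 ^ card S - 1"
    using insert.IH insert.prems S by simp
  from sieve_step_error[OF this mq[of b] mq[of c], of "[u q = v q] (mod q)"]
  show ?case
    unfolding rec sieve_density_insert[OF insert.hyps] card_insert_disjoint[OF insert.hyps]
    by simp
qed

section \<open>The representation count\<close>

lemma delta_eq_0_iff:
  assumes "q > 0"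
  shows "delta q (int n) = 0 \<longleftrightarrow> q dvd n"
proof -
  have "\<lfloor>real_of_int (int n) / real q\<rfloor> = int n div int q"
    by (metis floor_divide_of_int_eq of_int_of_nat_eq)
  then have "delta q (int n) = int n mod int q"
    unfolding delta_def by (simp only: minus_mult_div_eq_mod)
  then show ?thesis by (simp only: zmod_int [symmetric] of_nat_eq_0_iff dvd_eq_mod_eq_0)
qed

text \<open>The ordering condition in \<open>gP\<close> is met by one of the pairs
  \<open>(h, N - h)\<close> and \<open>(N - h, h)\<close>.\<close>

lemma gP_pos_if_coprime:
  assumes "0 < h" "h < N" "coprime h (6 * P)" "coprime (N - h) (6 * P)"
  shows "gP P N > 0"
proof -
  define A where "A = {(h, k). 0 < h \<and> 0 < k \<and> h + k = N \<and> h \<le> k \<and>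
    gcd h (6 * P) = 1 \<and> gcd k (6 * P) = 1}"
  have "A \<subseteq> {..N} \<times> {..N}" unfolding A_def by auto
  then have "finite A" by (rule finite_subset) simp
  moreover have "(h, N - h) \<in> A \<or> (N - h, h) \<in> A"
    using assms linear[of h "N - h"] unfolding A_def by simp
  then have "A \<noteq> {}" by blast
  ultimately show ?thesis unfolding gP_def A_def [symmetric] by (simp add: card_gt_0_iff)
qed

text \<open>Both \<open>h\<close> and \<open>2 * n - h\<close> have to be 1 or 5 mod 6. For
  \<open>n\<close> congruent to 0, 1, 2 mod 3, the chosen class gives \<open>2 * n - h\<close> the
  residue 5, 1, 5.\<close>

lemma coprime_6_diff_cong:
  fixes n h :: nat
  assumes "h < 2 * n" "[h = (if n mod 3 = 2 then 5 else 1)] (mod 6)"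
  shows "coprime h 6" "coprime (2 * n - h) 6"
proof -
  have 6: "coprime x 6" if "x mod 6 = 1 \<or> x mod 6 = 5" for x :: nat
  proof -
    have "coprime 5 (Suc 5)" by (rule coprime_Suc_right_nat)
    then have "coprime (5::nat) 6" by (simp only: Suc_numeral Num.add_num_simps)
    then have "coprime (x mod 6) 6" using that by (metis coprime_1_left)
    then show ?thesis by simp
  qed
  have h: "h mod 6 = (if n mod 3 = 2 then 5 else 1)" using assms(2) by (simp add: cong_def split: if_splits)
  then show "coprime h 6" by (intro 6) simp
  define x where "x = (2 * n - h) mod 6"
  have "(x + h mod 6) mod 6 = (2 * n) mod (2 * 3)"
    using assms(1) by (simp add: x_def mod_simps)
  then have "(x + h mod 6) mod 6 = 2 * (n mod 3)" by (simp only: mod_mult_mult1)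
  moreover have "x < 6" by (simp add: x_def)
  moreover have "n mod 3 = 0 \<or> n mod 3 = 1 \<or> n mod 3 = 2" by linarith
  ultimately have "x = 1 \<or> x = 5" unfolding h by (elim disjE) (simp_all, presburger+)
  then have "(2 * n - h) mod 6 = 1 \<or> (2 * n - h) mod 6 = 5" by (simp only: x_def)
  then show "coprime (2 * n - h) 6" by (rule 6)
qed

theorem corollary5p3:
  fixes r n P M :: nat and p :: "nat \<Rightarrow> nat"
  assumes "r \<ge> 1"
    and "\<And>i. i \<in> {1..r} \<Longrightarrow> prime (p i) \<and> p i \<ge> 5"
    and "inj_on p {1..r}"
    and "P = (\<Prod>i = 1..r. p i)"
    and "M = 6 * P"
    and "n > 0"
    and "real n / real M * real_of_int (kappa r p n) \<ge> 3 ^ r - 1"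
  shows "gP P (2 * n) > 0"
proof -
  define S where "S = p ` {1..r}"
  define a :: nat where "a = (if n mod 3 = 2 then 5 else 1)"
  \<comment> \<open>Avoiding the class 0 keeps \<open>q\<close> from dividing \<open>h\<close>;
    avoiding the class of \<open>2 * n\<close> keeps it from dividing
    \<open>2 * n - h\<close>.\<close>
  define u v :: "nat \<Rightarrow> nat" where "u = (\<lambda>_. 0)" and "v = (\<lambda>_. 2 * n)"
  define A where "A = sieve_set u v (2 * n) 6 a S"
  define D where "D = sieve_density u v S"
  have S: "finite S" "card S = r" "S \<noteq> {}"
    using assms(1,3) by (auto simp: S_def card_image)
  have prime: "prime q" "q \<ge> 5" if "q \<in> S" for q using that assms(2) by (auto simp: S_def)
  have q0: "q > 0" if "q \<in> S" for q using prime(2)[OF that] by simp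
  have cop: "coprime 6 q" if "q \<in> S" for q
  proof -
    have "coprime 2 q" "coprime 3 q" by (intro primes_coprime; use prime[OF that] in auto)+
    then have "coprime (2 * 3) q" by (simp only: coprime_mult_left_iff)
    then show ?thesis by simp
  qed
  have pw: "pairwise coprime S"
    unfolding pairwise_def using prime by (auto intro: primes_coprime)
  have iff: "[u q = v q] (mod q) \<longleftrightarrow> q dvd n" if "q \<in> S" for q
  proof -
    have "coprime q 2" by (intro primes_coprime; use prime[OF that] in auto)+
    then show ?thesis
      by (simp add: u_def v_def cong_0_iff cong_sym_eq[of 0] coprime_dvd_mult_right_iff)
  qed

  define K where "K = (\<Prod>i = 1..r. int (p i) - 2 + eps p i n)"
  have P: "real P = (\<Prod>i = 1..r. real (p i))" and P0: "P > 0"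
    using assms(2) by (auto simp: assms(4) intro!: prod_pos prime_gt_0_nat)
  have "D = (\<Prod>i = 1..r. 1 - (if [u (p i) = v (p i)] (mod p i) then 1 else 2) / real (p i))"
    unfolding D_def sieve_density_def S_def using assms(3) by (simp add: prod.reindex)
  also have "\<dots> = (\<Prod>i = 1..r. real_of_int (int (p i) - 2 + eps p i n) / real (p i))"
  proof (rule prod.cong)
    fix i assume "i \<in> {1..r}"
    then have "p i \<in> S" by (simp add: S_def)
    from iff[OF this] q0[OF this]
    show "1 - (if [u (p i) = v (p i)] (mod p i) then 1 else 2) / real (p i) =
        real_of_int (int (p i) - 2 + eps p i n) / real (p i)"
      by (simp add: eps_def delta_eq_0_iff field_simps)
  qed simp
  also have "\<dots> = real_of_int K / real P" by (simp add: K_def P prod_dividef)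
  finally have "D = real_of_int K / real P" .
  \<comment> \<open>\<open>T\<close> is the left-hand side of the hypothesis without the factor
    belonging to the prime 3.\<close>
  moreover define T where "T = real n / real M * real_of_int K"
  ultimately have D: "real (2 * n) / real 6 * D = 2 * T"
    using P0 by (simp only: assms(5) T_def) (simp add: field_simps)

  have "card A > 0"
  proof (cases "3 dvd n")
    case True
    then have "6 dvd 2 * n" by presburger
    \<comment> \<open>The main term may equal \<open>3 ^ r - 1\<close>, so the strict form for
      nonempty \<open>S\<close> is essential.\<close>
    then have "\<bar>real (card A) - real (2 * n) / real 6 * D\<bar> < 3 ^ r - 1"
      using card_sieve_set_error_dvd[of S 6 "2 * n" u v a] S q0 cop pw unfolding A_def D_def by simp
    moreover have "kappa r p n = 2 * K" using True by (simp add: kappa_def K_def delta_eq_0_iff)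
    then have "real n / real M * real_of_int (kappa r p n) = 2 * T"
      by (simp add: T_def)
    ultimately have "real (card A) > 0" using assms(7) unfolding D by linarith
    then show ?thesis by simp
  next
    case False
    have "\<bar>real (card A) - real (2 * n) / real 6 * D\<bar> < 3 ^ r"
      using card_sieve_set_error[of S 6 u v "2 * n" a] S q0 cop pw unfolding A_def D_def by simp
    moreover have "kappa r p n = K" using False by (simp add: kappa_def K_def delta_eq_0_iff)
    then have "T \<ge> 3 ^ r - 1" using assms(7) by (simp add: T_def)
    \<comment> \<open>This makes the main term \<open>2 * T \<ge> 2 * (3 ^ r - 1)\<close> at least
      \<open>3 ^ r\<close>.\<close>
    moreover have "(3::real) ^ r \<ge> 3" using assms(1) by (simp add: self_le_power)
    ultimately have "real (card A) > 0" unfolding D by linarith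
    then show ?thesis by simp
  qed
  then obtain h where "h \<in> A" by (auto simp: card_gt_0_iff)
  then have h: "h < 2 * n" "[h = a] (mod 6)"
    and hS: "\<And>q. q \<in> S \<Longrightarrow> \<not> q dvd h \<and> \<not> [h = 2 * n] (mod q)"
    by (auto simp: A_def sieve_set_def u_def v_def cong_0_iff)
  \<comment> \<open>The sieved range starts at 0, but any \<open>q\<close> in \<open>S\<close>
    divides 0 and so removes it.\<close>
  obtain q where "q \<in> S" using S(3) by blast
  then have "h > 0" using hS by (intro gr0I) auto
  have "coprime h (p i) \<and> coprime (2 * n - h) (p i)" if "i \<in> {1..r}" for i
  proof -
    have pS: "p i \<in> S" using that by (simp add: S_def)
    have "\<not> p i dvd 2 * n - h"
      using hS[OF pS] h(1) by (simp add: cong_altdef_nat cong_sym_eq[of h])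
    then show ?thesis
      using hS[OF pS] prime(1)[OF pS] by (metis prime_imp_coprime coprime_commute)
  qed
  then have "coprime h P" "coprime (2 * n - h) P"
    unfolding assms(4) by (auto intro: prod_coprime_right)
  with coprime_6_diff_cong[OF h(1)] h \<open>h > 0\<close> show ?thesis
    by (intro gP_pos_if_coprime[of h]) (simp_all add: a_def)
qed

end
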